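(* Let $\mathbb{D}=\mathbb{R},\mathbb{C}$ or $\mathbb{H}$, and let $X\in\mathfrak{gl}(n,\mathbb{D})$, with Jordan canonical form over $\mathbb{D}$ as described in the context. Consider the finite collection (with multiplicity) of Jordan blocks of $X$, where a block is identified with any matrix of the same size conjugate to it by an invertible matrix over $\mathbb{D}$. Then $X$ is $\mathrm{Ad}_{\mathrm{GL}(n,\mathbb{D})}$-real if and only if the following holds: (1) For $\mathbb{D}=\mathbb{R}$: the blocks can be partitioned into pairs of the form $\{\mathrm{J}_{\mathbb{R}}(\mu\pm \mathbf{i}\nu,2t),\ \mathrm{J}_{\mathbb{R}}(-\mu\mp \mathbf{i}\nu,2t)\}$ or $\{\mathrm{J}(\lambda,s),\mathrm{J}(-\lambda,s)\}$, or singletons of the form $\{\mathrm{J}_{\mathbb{R}}(0\pm \mathbf{i}\nu,2\ell)\}$ or $\{\mathrm{J}(0,m)\}$, where $\lambda,\mu,\nu\in\mathbb{R}$ with $\lambda,\mu\neq 0$ and $\nu>0$. (2) For $\mathbb{D}=\mathbb{C}$: the blocks can be partitioned into pairs of the form $\{\mathrm{J}(\lambda,s),\mathrm{J}(-\lambda,s)\}$ or singletons of the form $\{\mathrm{J}(0,m)\}$, where $\lambda\in\mathbb{C}$ and $\lambda\neq 0$. (3) For $\mathbb{D}=\mathbb{H}$: the blocks can be partitioned into pairs of the form $\{\mathrm{J}(\lambda,s),\mathrm{J}(-\lambda,s)\}$ or singletons of the form $\{\mathrm{J}(\mu,m)\}$, where $\lambda,\mu\in\mathbb{C}$ have non-negative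 imaginary parts, the real part of $\lambda$ is non-zero and the real part of $\mu$ is $0$. (The parameters $\lambda,\mu,\nu,s,t,\ell,m$ may differ from one pair or singleton to another.)
   Context: $\mathbb{H}=\mathbb{R}+\mathbb{R}\mathbf{i}+\mathbb{R}\mathbf{j}+\mathbb{R}\mathbf{k}$ denotes the quaternions, with $\mathbb{C}=\mathbb{R}+\mathbb{R}\mathbf{i}\subset\mathbb{H}$. $\mathfrak{gl}(n,\mathbb{D})=\mathrm{M}(n,\mathbb{D})$ is the space of $n\times n$ matrices over $\mathbb{D}$, and $\mathrm{GL}(n,\mathbb{D})$ acts on it by conjugation. An element $X\in\mathfrak{gl}(n,\mathbb{D})$ is called $\mathrm{Ad}_{\mathrm{GL}(n,\mathbb{D})}$-real if $gXg^{-1}=-X$ for some $g\in\mathrm{GL}(n,\mathbb{D})$. Jordan blocks: $\mathrm{J}(\lambda,m)$ is the $m\times m$ matrix with $\lambda$ on the diagonal, $1$ on all superdiagonal entries, and $0$ elsewhere. Let $\psi(z)=\begin{pmatrix}\mathrm{Re}(z)&\mathrm{Im}(z)\\-\mathrm{Im}(z)&\mathrm{Re}(z)\end{pmatrix}$ for $z\in\mathbb{C}$ and let $\Psi:\mathrm{M}(n,\mathbb{C})\to\mathrm{M}(2n,\mathbb{R})$ replace each entry $z$ by the $2\times 2$ block $\psi(z)$. For $\mu,\nu\in\mathbb{R}$ with $\nu>0$, $\mathrm{J}_{\mathbb{R}}(\mu\pm\mathbf{i}\nu,2n):=\Psi(\mathrm{J}(\mu+\mathbf{i}\nu,n))$ and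 $\mathrm{J}_{\mathbb{R}}(\mu\mp\mathbf{i}\nu,2n):=\Psi(\mathrm{J}(\mu-\mathbf{i}\nu,n))\in\mathrm{M}(2n,\mathbb{R})$; these two matrices are conjugate in $\mathrm{GL}(2n,\mathbb{R})$. Jordan canonical form: every matrix in $\mathrm{M}(n,\mathbb{D})$ is conjugate under $\mathrm{GL}(n,\mathbb{D})$ to a block diagonal matrix, unique up to permutation of the blocks, whose diagonal blocks are: for $\mathbb{D}=\mathbb{R}$, blocks $\mathrm{J}(\lambda,m)$ with $\lambda\in\mathbb{R}$ and $\mathrm{J}_{\mathbb{R}}(\mu\pm\mathbf{i}\nu,2\ell)$ with $\mu,\nu\in\mathbb{R}$, $\nu>0$; for $\mathbb{D}=\mathbb{C}$, blocks $\mathrm{J}(\lambda,m)$ with $\lambda\in\mathbb{C}$; for $\mathbb{D}=\mathbb{H}$, blocks $\mathrm{J}(\lambda,m)$ with $\lambda\in\mathbb{C}$ having non-negative imaginary part. These are the Jordan blocks of the matrix. Over $\mathbb{H}$, $\mathrm{J}(\lambda,m)$ and $\mathrm{J}(\overline{\lambda},m)$ are conjugate for $\lambda\in\mathbb{C}$. *)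

theory Defs
  imports
    Complex_Main
    "HOL-Library.Multiset"
    "Jordan_Normal_Form.Jordan_Normal_Form"
begin

section \<open>Quaternions\<close>

text \<open>The element \<open>Quat a b c d\<close> is \<open>a + b i + c j + d k\<close>.\<close>

datatype quat = Quat (qRe: real) (qI: real) (qJ: real) (qK: real)

lemma quat_eq_iff:
  "p = q \<longleftrightarrow> qRe p = qRe q \<and> qI p = qI q \<and> qJ p = qJ q \<and> qK p = qK q"
  by (cases p; cases q) auto

definition quat_norm_sq :: "quat \<Rightarrow> real" where
  "quat_norm_sq q = (qRe q)\<^sup>2 + (qI q)\<^sup>2 + (qJ q)\<^sup>2 + (qK q)\<^sup>2"

instantiation quat :: ring_1
begin

definition "0 = Quat 0 0 0 0"
definition "1 = Quat 1 0 0 0"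
definition "p + q = Quat (qRe p + qRe q) (qI p + qI q) (qJ p + qJ q) (qK p + qK q)"
definition "p - q = Quat (qRe p - qRe q) (qI p - qI q) (qJ p - qJ q) (qK p - qK q)"
definition "- p = Quat (- qRe p) (- qI p) (- qJ p) (- qK p)" for p :: quat
definition "p * q = Quat
  (qRe p * qRe q - qI p * qI q - qJ p * qJ q - qK p * qK q)
  (qRe p * qI q + qI p * qRe q + qJ p * qK q - qK p * qJ q)
  (qRe p * qJ q - qI p * qK q + qJ p * qRe q + qK p * qI q)
  (qRe p * qK q + qI p * qJ q - qJ p * qI q + qK p * qRe q)"

instance
  by standard
    (auto simp: zero_quat_def one_quat_def plus_quat_def minus_quat_def uminus_quat_def
      times_quat_def quat_eq_iff algebra_simps)

end

instantiation quat :: division_ring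
begin

definition "inverse q = Quat (qRe q / quat_norm_sq q) (- qI q / quat_norm_sq q)
  (- qJ q / quat_norm_sq q) (- qK q / quat_norm_sq q)"
definition "p div q = p * inverse q" for p q :: quat

instance
proof
  fix a b :: quat
  show "a div b = a * inverse b"
    by (rule divide_quat_def)
  show "inverse (0::quat) = 0"
    by (simp add: inverse_quat_def zero_quat_def)
  assume "a \<noteq> 0"
  then have "quat_norm_sq a \<noteq> 0"
    unfolding quat_norm_sq_def quat_eq_iff zero_quat_def
    by (auto simp: add_nonneg_eq_0_iff)
  then show "inverse a * a = 1" "a * inverse a = 1"
    by (simp_all add: inverse_quat_def times_quat_def one_quat_def field_simps)
      (simp_all add: quat_norm_sq_def power2_eq_square algebra_simps)
qed

end

definition quat_of_complex :: "complex \<Rightarrow> quat" where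
  "quat_of_complex z = Quat (Re z) (Im z) 0 0"

section \<open>Realness for the adjoint action\<close>

text \<open>Here \<open>h\<close> is the inverse of \<open>g\<close>.\<close>

definition Ad_GL_real :: "nat \<Rightarrow> 'a :: ring_1 mat \<Rightarrow> bool" where
  "Ad_GL_real n X \<longleftrightarrow>
    (\<exists>g\<in>carrier_mat n n. \<exists>h\<in>carrier_mat n n.
      g * h = 1\<^sub>m n \<and> h * g = 1\<^sub>m n \<and> g * X * h = - X)"

section \<open>Jordan blocks and Jordan canonical forms\<close>

definition psi :: "complex \<Rightarrow> real mat" where
  "psi z = mat_of_rows_list 2 [[Re z, Im z], [- Im z, Re z]]"

definition Psi :: "complex mat \<Rightarrow> real mat" where
  "Psi A = mat (2 * dim_row A) (2 * dim_col A)
     (\<lambda>(i, j). psi (A $$ (i div 2, j div 2)) $$ (i mod 2, j mod 2))"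

text \<open>
  \<open>real_jordan_block l \<mu> \<nu>\<close> has size \<open>2 * l\<close>. For \<open>\<nu> > 0\<close> it is
  \<open>J\<^sub>\<real>(\<mu> \<plusminus> i\<nu>, 2l)\<close>, and \<open>J\<^sub>\<real>(\<mu> \<mp> i\<nu>, 2l)\<close> is
  \<open>real_jordan_block l \<mu> (-\<nu>)\<close>.
\<close>

definition real_jordan_block :: "nat \<Rightarrow> real \<Rightarrow> real \<Rightarrow> real mat" where
  "real_jordan_block l \<mu> \<nu> = Psi (jordan_block l (Complex \<mu> \<nu>))"

definition quat_jordan_block :: "nat \<Rightarrow> complex \<Rightarrow> quat mat" where
  "quat_jordan_block m z = jordan_block m (quat_of_complex z)"

definition canonical_blocks_R :: "real mat set" where
  "canonical_blocks_R =
     {jordan_block m r | m r. m \<ge> 1} \<union>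
     {real_jordan_block l \<mu> \<nu> | l \<mu> \<nu>. l \<ge> 1 \<and> \<nu> > 0}"

definition canonical_blocks_C :: "complex mat set" where
  "canonical_blocks_C = {jordan_block m z | m z. m \<ge> 1}"

definition canonical_blocks_H :: "quat mat set" where
  "canonical_blocks_H = {quat_jordan_block m z | m z. m \<ge> 1 \<and> Im z \<ge> 0}"

definition jordan_canonical_form ::
    "'a :: ring_1 mat set \<Rightarrow> 'a mat \<Rightarrow> 'a mat list \<Rightarrow> bool" where
  "jordan_canonical_form \<B> X Bs \<longleftrightarrow>
     set Bs \<subseteq> \<B> \<and> similar_mat X (diag_block_mat Bs)"

section \<open>Partitions of a collection of blocks\<close>

text \<open>
  The collection \<open>M\<close> is split into parts, each of which agrees with one of the prescribed
  pairs or singletons in \<open>\<P>\<close> once conjugate blocks are identified. Multiset union of the parts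
  accounts for multiplicities.
\<close>

definition partitionable_into ::
    "'a :: ring_1 mat multiset set \<Rightarrow> 'a mat multiset \<Rightarrow> bool" where
  "partitionable_into \<P> M \<longleftrightarrow>
     (\<exists>Ps :: 'a mat multiset multiset.
        \<Sum>\<^sub># Ps = M \<and> (\<forall>P\<in>#Ps. \<exists>Q\<in>\<P>. rel_mset similar_mat P Q))"

definition parts_R :: "real mat multiset set" where
  "parts_R =
     {{# real_jordan_block t \<mu> \<nu>, real_jordan_block t (- \<mu>) (- \<nu>) #}
        | t \<mu> \<nu>. t \<ge> 1 \<and> \<mu> \<noteq> 0 \<and> \<nu> > 0} \<union>
     {{# jordan_block s r, jordan_block s (- r) #} | s r. s \<ge> 1 \<and> r \<noteq> 0} \<union>
     {{# real_jordan_block l 0 \<nu> #} | l \<nu>. l \<ge> 1 \<and> \<nu> > 0} \<union>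
     {{# jordan_block m 0 #} | m. m \<ge> 1}"

definition parts_C :: "complex mat multiset set" where
  "parts_C =
     {{# jordan_block s z, jordan_block s (- z) #} | s z. s \<ge> 1 \<and> z \<noteq> 0} \<union>
     {{# jordan_block m 0 #} | m. m \<ge> 1}"

definition parts_H :: "quat mat multiset set" where
  "parts_H =
     {{# quat_jordan_block s z, quat_jordan_block s (- z) #}
        | s z. s \<ge> 1 \<and> Im z \<ge> 0 \<and> Re z \<noteq> 0} \<union>
     {{# quat_jordan_block m w #} | m w. m \<ge> 1 \<and> Im w \<ge> 0 \<and> Re w = 0}"

end

theory Submission
  imports Defs "Jordan_Normal_Form.Jordan_Normal_Form_Uniqueness"
begin

text \<open>
  If \<open>X\<close> has the blocks \<open>B\<^sub>1, \<dots>, B\<^sub>k\<close>, then \<open>- X\<close> has the blocks \<open>- B\<^sub>1, \<dots>, - B\<^sub>k\<close>, and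
  conjugation by \<open>diag (1, -1, 1, \<dots>)\<close> shows \<open>- J (\<lambda>, m) \<sim> J (- \<lambda>, m)\<close>. Hence negation acts on
  canonical blocks through an involution of their labels: \<open>(m, z) \<mapsto> (m, - z)\<close> over the complex numbers,
  \<open>(m, z) \<mapsto> (m, - cnj z)\<close> over the reals and the quaternions, where labels have \<open>Im z \<ge> 0\<close>.
  By uniqueness of the canonical form, \<open>X \<sim> - X\<close> means that the multiset of labels is invariant
  under the involution, i.e. that it splits into orbits; these are the prescribed pairs and singletons.
  Uniqueness over the reals and the quaternions follows from the complex case, since there a block with
  label \<open>(m, z)\<close> becomes \<open>J (z, m) \<oplus> J (cnj z, m)\<close> (over the reals for \<open>Im z \<noteq> 0\<close> only).
\<close>

section \<open>Similarity of block diagonal matrices\<close>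

lemma similar_mat_square: "similar_mat A B \<Longrightarrow> square_mat A" "similar_mat A B \<Longrightarrow> square_mat B"
  by (auto dest!: similar_matD)

lemma similar_mat_uminus:
  fixes A B :: "'a :: ring_1 mat"
  assumes "similar_mat A B"
  shows "similar_mat (- A) (- B)"
proof -
  obtain n P Q where *: "{A, B, P, Q} \<subseteq> carrier_mat n n" "P * Q = 1\<^sub>m n" "Q * P = 1\<^sub>m n" "A = P * B * Q"
    using similar_matD[OF assms] by blast
  have "- A = P * (- B) * Q"
    using * by (auto simp: uminus_mult_left_mat uminus_mult_right_mat simp del: assoc_mult_mat)
  then show ?thesis
    using * by (intro similar_matI[of _ _ P Q n]) auto
qed

text \<open>The conjugating matrix is the block permutation exchanging the two coordinate ranges;
  \<open>?Q\<close> is its inverse.\<close>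

lemma similar_mat_four_block_swap:
  fixes A B :: "'a :: semiring_1 mat"
  assumes A: "A \<in> carrier_mat n n" and B: "B \<in> carrier_mat m m"
  shows "similar_mat (four_block_mat A (0\<^sub>m n m) (0\<^sub>m m n) B) (four_block_mat B (0\<^sub>m m n) (0\<^sub>m n m) A)"
proof -
  let ?P = "four_block_mat (0\<^sub>m n m) (1\<^sub>m n) (1\<^sub>m m) (0\<^sub>m m n) :: 'a mat"
  let ?Q = "four_block_mat (0\<^sub>m m n) (1\<^sub>m m) (1\<^sub>m n) (0\<^sub>m n m) :: 'a mat"
  let ?BA = "four_block_mat B (0\<^sub>m m n) (0\<^sub>m n m) A"
  have PB: "?P * ?BA = four_block_mat (0\<^sub>m n m) A B (0\<^sub>m m n)"
    by (subst mult_four_block_mat[of _ n m _ n _ m _ _ m _ n]) (use A B in auto)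
  have ABPQ: "four_block_mat A (0\<^sub>m n m) (0\<^sub>m m n) B = ?P * ?BA * ?Q"
    unfolding PB by (subst mult_four_block_mat[of _ n m _ n _ m _ _ n _ m]) (use A B in auto)
  have PQ: "?P * ?Q = 1\<^sub>m (n + m)"
    by (subst mult_four_block_mat[of _ n m _ n _ m _ _ n _ m]) auto
  have QP: "?Q * ?P = 1\<^sub>m (n + m)"
    by (subst mult_four_block_mat[of _ m n _ m _ n _ _ m _ n]) (auto simp: add.commute)
  have "?P \<in> carrier_mat (n + m) (m + n)" "?Q \<in> carrier_mat (m + n) (n + m)"
    by (rule four_block_carrier_mat; simp)+
  moreover have "four_block_mat A (0\<^sub>m n m) (0\<^sub>m m n) B \<in> carrier_mat (n + m) (n + m)"
    "?BA \<in> carrier_mat (m + n) (m + n)"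
    using A B by simp_all
  ultimately show ?thesis
    \<comment> \<open>The two orders of the blocks produce the sizes \<open>n + m\<close> and
      \<open>m + n\<close>, which have to be identified for all four matrices.\<close>
    by (intro similar_matI[OF _ PQ QP ABPQ]) (simp only: add.commute[of m n] insert_subset empty_subsetI)
qed

text \<open>The condition on \<open>f\<close> keeps the off-diagonal blocks zero. It serves negation
  as well as the entrywise passages between the number systems.\<close>

lemma diag_block_mat_map:
  assumes "f 0 = 0"
  shows "map_mat f (diag_block_mat As) = diag_block_mat (map (map_mat f) As)"
proof (induction As)
  case (Cons A As)
  let ?D = "diag_block_mat As"
  let ?U = "0\<^sub>m (dim_row A) (dim_col ?D)" and ?L = "0\<^sub>m (dim_row ?D) (dim_col A)"
  have "map_mat f (four_block_mat A ?U ?L ?D)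
    = four_block_mat (map_mat f A) (map_mat f ?U) (map_mat f ?L) (map_mat f ?D)"
    by (rule map_four_block_mat) auto
  moreover have "map_mat f (0\<^sub>m r c) = 0\<^sub>m r c" for r c
    using assms by (auto intro: eq_matI)
  ultimately show ?case
    by (simp add: Let_def Cons.IH[symmetric])
qed auto

lemma uminus_mat_map: "- A = map_mat uminus A"
  by (auto intro: eq_matI)

lemma diag_block_mat_uminus:
  fixes As :: "'a :: group_add mat list"
  shows "- diag_block_mat As = diag_block_mat (map uminus As)"
  unfolding uminus_mat_map[abs_def] by (rule diag_block_mat_map) simp

lemma similar_mat_diag_block_mat_append_swap:
  fixes As Bs :: "'a :: semiring_1 mat list"
  assumes "\<forall>A\<in>set As. square_mat A" "\<forall>B\<in>set Bs. square_mat B"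
  shows "similar_mat (diag_block_mat (As @ Bs)) (diag_block_mat (Bs @ As))"
proof -
  obtain n m where "diag_block_mat As \<in> carrier_mat n n" "diag_block_mat Bs \<in> carrier_mat m m"
    using assms by (metis carrier_matI diag_block_mat_square square_mat.elims(2))
  then show ?thesis
    using similar_mat_four_block_swap[of "diag_block_mat As" n "diag_block_mat Bs" m]
    by (simp only: diag_block_mat_append Let_def carrier_matD)
qed

lemma similar_mat_diag_block_mat_append:
  fixes As Bs :: "'a :: semiring_1 mat list"
  assumes "similar_mat (diag_block_mat As) (diag_block_mat As')"
    and "similar_mat (diag_block_mat Bs) (diag_block_mat Bs')"
  shows "similar_mat (diag_block_mat (As @ Bs)) (diag_block_mat (As' @ Bs'))"
proof -
  obtain n m where
    "{diag_block_mat As, diag_block_mat As'} \<subseteq> carrier_mat n n"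
    "{diag_block_mat Bs, diag_block_mat Bs'} \<subseteq> carrier_mat m m"
    using similar_matD[OF assms(1)] similar_matD[OF assms(2)] by auto
  then show ?thesis
    using similar_mat_four_block_0_0[OF assms, of n m]
    by (auto simp: diag_block_mat_append Let_def)
qed

lemma similar_mat_refl_square: "square_mat A \<Longrightarrow> similar_mat A A"
  by (rule similar_mat_refl[of A "dim_row A"]) auto

text \<open>By induction: the head \<open>A\<close> is located in \<open>Bs\<close> and moved past
  the blocks \<open>B1\<close> before it by a swap, while \<open>B2\<close> stays in place.\<close>

lemma similar_mat_diag_block_mat_perm:
  fixes As Bs :: "'a :: semiring_1 mat list"
  assumes "mset As = mset Bs" "\<forall>A\<in>set As. square_mat A"
  shows "similar_mat (diag_block_mat As) (diag_block_mat Bs)"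
  using assms
proof (induction As arbitrary: Bs)
  case Nil
  then show ?case by (auto intro: similar_mat_refl[of _ 0])
next
  case (Cons A As)
  have "A \<in> set Bs" using Cons.prems(1) by (metis list.set_intros(1) set_mset_mset)
  then obtain B1 B2 where Bs: "Bs = B1 @ A # B2" by (meson split_list)
  have sq: "\<forall>B\<in>set Bs. square_mat B" using Cons.prems by (metis set_mset_mset)
  have "similar_mat (diag_block_mat As) (diag_block_mat (B1 @ B2))"
    using Cons by (auto simp: Bs)
  from similar_mat_diag_block_mat_append[OF similar_mat_refl_square this, of "[A]"]
  have "similar_mat (diag_block_mat (A # As)) (diag_block_mat (A # B1 @ B2))"
    using sq Bs by simp
  moreover have "similar_mat (diag_block_mat (A # B1 @ B2)) (diag_block_mat Bs)"
  proof -
    have "similar_mat (diag_block_mat (([A] @ B1) @ B2)) (diag_block_mat ((B1 @ [A]) @ B2))"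
      using sq Bs
      by (intro similar_mat_diag_block_mat_append similar_mat_diag_block_mat_append_swap
          similar_mat_refl_square diag_block_mat_square) auto
    then show ?thesis by (simp add: Bs)
  qed
  ultimately show ?case by (rule similar_mat_trans)
qed

lemma similar_mat_diag_block_mat_list_all2:
  assumes "list_all2 similar_mat As Bs"
  shows "similar_mat (diag_block_mat As) (diag_block_mat Bs)"
proof -
  have "similar_mat (diag_block_mat (map fst (zip As Bs))) (diag_block_mat (map snd (zip As Bs)))"
    using assms by (intro similar_diag_mat_block_mat) (auto simp: list_all2_iff)
  then show ?thesis using list_all2_lengthD[OF assms] by simp
qed

text \<open>A multiset relation is a listwise relation between suitable reorderings, so one
  permutes, compares block by block, and permutes again.\<close>

lemma similar_mat_diag_block_mat_rel_mset:
  fixes As Bs :: "'a :: semiring_1 mat list"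
  assumes "rel_mset similar_mat (mset As) (mset Bs)"
  shows "similar_mat (diag_block_mat As) (diag_block_mat Bs)"
proof -
  obtain As' Bs' where *: "mset As' = mset As" "mset Bs' = mset Bs" "list_all2 similar_mat As' Bs'"
    using assms by (auto simp: rel_mset_def)
  have sq: "\<forall>A\<in>set As'. square_mat A" "\<forall>B\<in>set Bs'. square_mat B"
    using *(3) by (metis in_set_conv_nth list_all2_conv_all_nth similar_mat_square)+
  show ?thesis
    using similar_mat_sym[OF similar_mat_diag_block_mat_perm[OF *(1) sq(1)]]
      similar_mat_diag_block_mat_list_all2[OF *(3)] similar_mat_diag_block_mat_perm[OF *(2) sq(2)]
    by (blast intro: similar_mat_trans)
qed

lemma Ad_GL_real_iff_similar_mat:
  assumes "X \<in> carrier_mat n n"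
  shows "Ad_GL_real n X \<longleftrightarrow> similar_mat X (- X)"
proof
  assume "Ad_GL_real n X"
  then obtain g h where "g \<in> carrier_mat n n" "h \<in> carrier_mat n n"
    "g * h = 1\<^sub>m n" "h * g = 1\<^sub>m n" "g * X * h = - X"
    unfolding Ad_GL_real_def by blast
  then show "similar_mat X (- X)"
    using assms by (intro similar_mat_sym[OF similar_matI[of "- X" X g h n]]) auto
next
  assume "similar_mat X (- X)"
  then obtain g h where gh: "similar_mat_wit (- X) X g h"
    using similar_mat_sym similar_mat_def by blast
  have "- X \<in> carrier_mat n n" using assms by simp
  note wit = similar_mat_witD2[OF this gh]
  show "Ad_GL_real n X"
    unfolding Ad_GL_real_def using wit(1,2,6,7) wit(3)[symmetric] by blast
qed

text \<open>Replacing both \<open>X\<close> and \<open>- X\<close> by block diagonal forms turns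
  realness into a statement about the list of blocks.\<close>

lemma Ad_GL_real_iff_diag_block_mat:
  assumes "X \<in> carrier_mat n n" "similar_mat X (diag_block_mat Bs)"
  shows "Ad_GL_real n X \<longleftrightarrow> similar_mat (diag_block_mat Bs) (diag_block_mat (map uminus Bs))"
  unfolding Ad_GL_real_iff_similar_mat[OF assms(1)] diag_block_mat_uminus[symmetric]
  using assms(2) similar_mat_uminus[OF assms(2)] by (metis similar_mat_sym similar_mat_trans)

section \<open>Multisets of blocks: relations up to similarity and splitting into orbits\<close>

lemma rel_mset_trans:
  assumes "transp R" "rel_mset R P Q" "rel_mset R Q S"
  shows "rel_mset R P S"
proof -
  have "rel_mset (R OO R) P S"
    using assms(2,3) by (auto simp: multiset.rel_compp)
  then show ?thesis
    by (rule rev_predicate2D[OF _ multiset.rel_mono]) (use assms(1) in \<open>auto dest: transpD\<close>)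
qed

lemma rel_mset_sym:
  assumes "symp R" "rel_mset R P Q"
  shows "rel_mset R Q P"
proof -
  have "R\<inverse>\<inverse> = R" using assms(1) by (auto simp: fun_eq_iff dest: sympD)
  then show ?thesis using assms(2) multiset.rel_flip[of R Q P] by simp
qed

lemma rel_mset_union:
  assumes "rel_mset R P Q" "rel_mset R P' Q'"
  shows "rel_mset R (P + P') (Q + Q')"
proof -
  obtain xs ys xs' ys' where "mset xs = P" "mset ys = Q" "list_all2 R xs ys"
    "mset xs' = P'" "mset ys' = Q'" "list_all2 R xs' ys'"
    using assms by (auto simp: rel_mset_def)
  then show ?thesis
    unfolding rel_mset_def by (intro exI[of _ "xs @ xs'"] exI[of _ "ys @ ys'"]) (auto intro: list_all2_appendI)
qed

text \<open>The combinatorial half of sufficiency: a part \<open>P\<close> matching a prescribed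
  \<open>Q\<close> satisfies P ~ Q ~ -Q ~ -P, and these relations add up over the parts.\<close>

lemma partitionable_into_imp_rel_mset_uminus:
  fixes M :: "'a :: ring_1 mat multiset"
  assumes "\<And>Q. Q \<in> \<P> \<Longrightarrow> rel_mset similar_mat Q (image_mset uminus Q)"
    and "partitionable_into \<P> M"
  shows "rel_mset similar_mat M (image_mset uminus M)"
proof -
  have tr: "transp (similar_mat :: 'a mat \<Rightarrow> _)" and sy: "symp (similar_mat :: 'a mat \<Rightarrow> _)"
    by (auto intro!: transpI sympI intro: similar_mat_trans similar_mat_sym)
  obtain Ps where M: "M = \<Sum>\<^sub># Ps" and Ps: "\<forall>P\<in>#Ps. \<exists>Q\<in>\<P>. rel_mset similar_mat P Q"
    using assms(2) by (auto simp: partitionable_into_def)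
  show ?thesis unfolding M using Ps
  proof (induction Ps)
    case empty
    then show ?case by (simp add: rel_mset_Zero)
  next
    case (add P Ps)
    then obtain Q where Q: "Q \<in> \<P>" "rel_mset similar_mat P Q" by auto
    have "rel_mset similar_mat (image_mset uminus P) (image_mset uminus Q)"
      unfolding multiset.rel_map
      by (rule rev_predicate2D[OF Q(2) multiset.rel_mono]) (auto intro: similar_mat_uminus)
    then have "rel_mset similar_mat P (image_mset uminus P)"
      using Q assms(1)[OF Q(1)] rel_mset_trans[OF tr] rel_mset_sym[OF sy] by meson
    with add show ?case by (simp add: rel_mset_union)
  qed
qed

text \<open>Strong induction on the size: an orbit is removed with multiplicity one, and the rest is
  again invariant.\<close>

lemma mset_partition_orbits:
  fixes \<sigma> :: "'a \<Rightarrow> 'a"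
  assumes "\<And>x. \<sigma> (\<sigma> x) = x" "image_mset \<sigma> N = N"
  shows "\<exists>Qs. \<Sum>\<^sub># Qs = N \<and>
    (\<forall>Q\<in>#Qs. \<exists>x\<in>#N. Q = (if \<sigma> x = x then {#x#} else {#x, \<sigma> x#}))"
  using assms(2)
proof (induction "size N" arbitrary: N rule: less_induct)
  case less
  show ?case
  proof (cases "N = {#}")
    case True
    then show ?thesis by (intro exI[of _ "{#}"]) auto
  next
    case False
    then obtain x where x: "x \<in># N" by auto
    define Q where "Q = (if \<sigma> x = x then {#x#} else {#x, \<sigma> x#})"
    \<comment> \<open>Invariance puts the partner of \<open>x\<close> into \<open>N\<close>; the
      pair is formed only when the two differ, so one copy of each is enough for \<open>Q\<close> to
      be contained in \<open>N\<close>.\<close>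
    have "\<sigma> x \<in># N" using x less.prems by (metis imageI set_image_mset)
    then have QN: "Q \<subseteq># N" using x
      by (auto simp: Q_def insert_subset_eq_iff in_diff_count)
    have "image_mset \<sigma> Q = Q" by (auto simp: Q_def assms(1))
    then have "image_mset \<sigma> (N - Q) = N - Q"
      using less.prems QN by (simp add: image_mset_Diff)
    moreover have "size (N - Q) < size N"
      using QN False by (simp add: size_Diff_submset Q_def nonempty_has_size)
    ultimately obtain Qs where Qs: "\<Sum>\<^sub># Qs = N - Q"
      "\<forall>Q'\<in>#Qs. \<exists>x\<in>#N - Q. Q' = (if \<sigma> x = x then {#x#} else {#x, \<sigma> x#})"
      using less.hyps[of "N - Q"] by blast
    show ?thesis
    proof (intro exI[of _ "add_mset Q Qs"] conjI ballI)
      show "\<Sum>\<^sub># (add_mset Q Qs) = N" using Qs(1) QN by simp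
    next
      fix Q' assume "Q' \<in># add_mset Q Qs"
      then consider "Q' = Q" | "Q' \<in># Qs" by auto
      then show "\<exists>x\<in>#N. Q' = (if \<sigma> x = x then {#x#} else {#x, \<sigma> x#})"
        using Qs(2) x Q_def by cases (blast dest: in_diffD)+
    qed
  qed
qed

section \<open>Conjugation by diagonal matrices\<close>

text \<open>Conjugation by the diagonal matrix with entries \<open>d i\<close>, whose inverse has
  entries \<open>e i\<close>. The result is spelled out entrywise so that each application is a
  check of entries: alternating signs, or the constant quaternion j.\<close>

lemma similar_mat_diag_conj:
  fixes A :: "'a :: ring_1 mat"
  assumes A: "A \<in> carrier_mat n n"
    and de: "\<And>i. i < n \<Longrightarrow> d i * e i = 1" "\<And>i. i < n \<Longrightarrow> e i * d i = 1"
  shows "similar_mat A (mat n n (\<lambda>(i, j). d i * A $$ (i, j) * e j))"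
proof (rule similar_mat_sym, rule similar_matI)
  show "mat_diag n d * mat_diag n e = 1\<^sub>m n" "mat_diag n e * mat_diag n d = 1\<^sub>m n"
    unfolding mat_diag_diag using de by (auto simp: mat_diag_def intro!: eq_matI)
  show "mat n n (\<lambda>(i, j). d i * A $$ (i, j) * e j) = mat_diag n d * A * mat_diag n e"
    using A by (subst mat_diag_mult_left[OF A], subst mat_diag_mult_right[of _ n]) (auto intro!: eq_matI)
qed (use A in auto)

lemma minus_one_power_conj:
  fixes x :: "'a :: ring_1"
  shows "(- 1) ^ i * x * (- 1) ^ j = (if even i = even j then x else - x)"
  by (cases "even i"; cases "even j") auto

lemma minus_one_power_mult_self: "(- 1 :: 'a :: ring_1) ^ i * (- 1) ^ i = 1"
  by (cases "even i") auto

text \<open>Alternating signs fix the diagonal entries and flip the superdiagonal, turning its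
  entries -1 back into 1.\<close>

lemma similar_mat_uminus_jordan_block:
  fixes a :: "'a :: ring_1"
  shows "similar_mat (- jordan_block n a) (jordan_block n (- a))"
proof -
  have "mat n n (\<lambda>(i, j). (- 1) ^ i * (- jordan_block n a) $$ (i, j) * (- 1) ^ j)
      = jordan_block n (- a)"
    unfolding minus_one_power_conj by (intro eq_matI) (auto simp: jordan_block_def)
  then show ?thesis
    using similar_mat_diag_conj[of "- jordan_block n a" n "\<lambda>i. (- 1) ^ i" "\<lambda>i. (- 1) ^ i"]
    by (simp add: minus_one_power_mult_self)
qed

section \<open>Real Jordan blocks\<close>

text \<open>Groups indices in consecutive pairs, matching the use of \<open>div 2\<close> and
  \<open>mod 2\<close> in \<open>Psi\<close>.\<close>

lemma sum_double_index:
  fixes f :: "nat \<Rightarrow> 'a :: comm_monoid_add"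
  shows "(\<Sum>k = 0..<2 * n. f k) = (\<Sum>k = 0..<n. f (2 * k) + f (2 * k + 1))"
  by (induction n) (simp_all add: add.assoc)

lemma psi_index:
  "psi z $$ (0, 0) = Re z" "psi z $$ (0, Suc 0) = Im z"
  "psi z $$ (Suc 0, 0) = - Im z" "psi z $$ (Suc 0, Suc 0) = Re z"
  by (simp_all add: psi_def mat_of_rows_list_def)

lemma Psi_carrier [simp]: "A \<in> carrier_mat n m \<Longrightarrow> Psi A \<in> carrier_mat (2 * n) (2 * m)"
  by (auto simp: Psi_def)

lemma dim_Psi [simp]: "dim_row (Psi A) = 2 * dim_row A" "dim_col (Psi A) = 2 * dim_col A"
  by (auto simp: Psi_def)

lemma Psi_index [simp]:
  "i < 2 * dim_row A \<Longrightarrow> j < 2 * dim_col A \<Longrightarrow>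
    Psi A $$ (i, j) = psi (A $$ (i div 2, j div 2)) $$ (i mod 2, j mod 2)"
  by (simp add: Psi_def)

lemma psi_uminus_index:
  assumes "i < 2" "j < 2"
  shows "psi (- z) $$ (i, j) = - psi z $$ (i, j)"
  using assms by (auto simp: less_2_cases_iff psi_index)

text \<open>Complex conjugation becomes conjugation by diag(1, -1), which flips the signs of the
  off-diagonal entries.\<close>

lemma psi_cnj_index:
  assumes "i < 2" "j < 2"
  shows "psi (cnj z) $$ (i, j) = (if even i = even j then psi z $$ (i, j) else - psi z $$ (i, j))"
  using assms by (auto simp: less_2_cases_iff psi_index)

lemma psi_mult_index:
  assumes "i < 2" "j < 2"
  shows "psi (z * w) $$ (i, j) = psi z $$ (i, 0) * psi w $$ (0, j) + psi z $$ (i, Suc 0) * psi w $$ (Suc 0, j)"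
  using assms by (auto simp: less_2_cases_iff psi_index)

lemma psi_sum_index:
  assumes "i < 2" "j < 2"
  shows "psi (sum f S) $$ (i, j) = (\<Sum>k\<in>S. psi (f k) $$ (i, j))"
  using assms by (auto simp: less_2_cases_iff psi_index sum_negf)

lemma Psi_mult:
  assumes "A \<in> carrier_mat n m" "B \<in> carrier_mat m l"
  shows "Psi (A * B) = Psi A * Psi B"
proof (rule eq_matI)
  fix i j assume "i < dim_row (Psi A * Psi B)" "j < dim_col (Psi A * Psi B)"
  then have ij: "i < 2 * n" "j < 2 * l" "i div 2 < n" "j div 2 < l"
    using assms by auto
  have "(Psi A * Psi B) $$ (i, j) = (\<Sum>k = 0..<2 * m. Psi A $$ (i, k) * Psi B $$ (k, j))"
    using ij assms by (simp add: scalar_prod_def)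
  also have "\<dots> = (\<Sum>k = 0..<m. psi (A $$ (i div 2, k) * B $$ (k, j div 2)) $$ (i mod 2, j mod 2))"
    unfolding sum_double_index using ij assms by (intro sum.cong) (simp_all add: psi_mult_index)
  also have "\<dots> = Psi (A * B) $$ (i, j)"
    using ij assms by (simp add: scalar_prod_def flip: psi_sum_index)
  finally show "Psi (A * B) $$ (i, j) = (Psi A * Psi B) $$ (i, j)" ..
qed (use assms in auto)

lemma div_mod_2_eqD: "i div 2 = j div 2 \<Longrightarrow> i mod 2 = j mod 2 \<Longrightarrow> i = j" for i j :: nat
  by (metis div_mult_mod_eq)

lemma Psi_one: "Psi (1\<^sub>m n) = 1\<^sub>m (2 * n)"
proof (rule eq_matI)
  fix i j assume "i < dim_row (1\<^sub>m (2 * n) :: real mat)" "j < dim_col (1\<^sub>m (2 * n) :: real mat)"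
  then have ij: "i < 2 * n" "j < 2 * n" "i div 2 < n" "j div 2 < n" by auto
  show "Psi (1\<^sub>m n) $$ (i, j) = 1\<^sub>m (2 * n) $$ (i, j)"
  proof (cases "i div 2 = j div 2")
    case True
    then have "i mod 2 = j mod 2 \<longleftrightarrow> i = j"
      using div_mod_2_eqD[of i j] by auto
    then show ?thesis
      using True ij by (auto simp: psi_index mod2_eq_if)
  next
    case False
    then show ?thesis
      using ij by (auto simp: psi_index mod2_eq_if)
  qed
qed auto

lemma Psi_uminus: "Psi (- A) = - Psi A"
proof (rule eq_matI)
  fix i j assume "i < dim_row (- Psi A)" "j < dim_col (- Psi A)"
  then have "i < 2 * dim_row A" "j < 2 * dim_col A" "i div 2 < dim_row A" "j div 2 < dim_col A" by auto
  then show "Psi (- A) $$ (i, j) = (- Psi A) $$ (i, j)"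
    by (simp add: psi_uminus_index)
qed auto

lemma similar_mat_Psi:
  assumes "similar_mat A B"
  shows "similar_mat (Psi A) (Psi B)"
proof -
  obtain n P Q where *: "{A, B, P, Q} \<subseteq> carrier_mat n n" "P * Q = 1\<^sub>m n" "Q * P = 1\<^sub>m n" "A = P * B * Q"
    using similar_matD[OF assms] by blast
  have c: "A \<in> carrier_mat n n" "B \<in> carrier_mat n n" "P \<in> carrier_mat n n" "Q \<in> carrier_mat n n"
    using *(1) by auto
  show ?thesis
  proof (rule similar_matI)
    show "{Psi A, Psi B, Psi P, Psi Q} \<subseteq> carrier_mat (2 * n) (2 * n)" using c by simp
    show "Psi P * Psi Q = 1\<^sub>m (2 * n)" "Psi Q * Psi P = 1\<^sub>m (2 * n)"
      using *(2,3) Psi_mult[OF c(3,4)] Psi_mult[OF c(4,3)] by (simp_all add: Psi_one)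
    show "Psi A = Psi P * Psi B * Psi Q"
      unfolding *(4) Psi_mult[OF mult_carrier_mat[OF c(3,2)] c(4)] Psi_mult[OF c(3,2)] ..
  qed
qed

lemma similar_mat_real_jordan_block_uminus:
  "similar_mat (- real_jordan_block l \<mu> \<nu>) (real_jordan_block l (- \<mu>) (- \<nu>))"
  using similar_mat_Psi[OF similar_mat_uminus_jordan_block, of l "Complex \<mu> \<nu>"]
  by (simp add: real_jordan_block_def Psi_uminus Complex_eq)

lemma real_jordan_block_carrier [simp]: "real_jordan_block l \<mu> \<nu> \<in> carrier_mat (2 * l) (2 * l)"
  by (simp add: real_jordan_block_def)

text \<open>The sign of \<open>(- 1) ^ i\<close> depends only on the position of \<open>i\<close>
  inside its 2 by 2 block, so every block is conjugated by diag(1, -1). This sends each complex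
  entry to its conjugate and fixes the real superdiagonal entries.\<close>

lemma similar_mat_real_jordan_block_cnj:
  "similar_mat (real_jordan_block l \<mu> \<nu>) (real_jordan_block l \<mu> (- \<nu>))"
proof -
  let ?J = "real_jordan_block l \<mu> \<nu>"
  have "mat (2 * l) (2 * l) (\<lambda>(i, j). (- 1) ^ i * ?J $$ (i, j) * (- 1) ^ j) = real_jordan_block l \<mu> (- \<nu>)"
  proof (rule eq_matI)
    fix i j assume "i < dim_row (real_jordan_block l \<mu> (- \<nu>))" "j < dim_col (real_jordan_block l \<mu> (- \<nu>))"
    then have "i < 2 * l" "j < 2 * l" "i div 2 < l" "j div 2 < l" by (auto simp: real_jordan_block_def)
    moreover from this have "jordan_block l (Complex \<mu> (- \<nu>)) $$ (i div 2, j div 2)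
        = cnj (jordan_block l (Complex \<mu> \<nu>) $$ (i div 2, j div 2))"
      by (simp add: complex_eq_iff)
    ultimately show "mat (2 * l) (2 * l) (\<lambda>(i, j). (- 1) ^ i * ?J $$ (i, j) * (- 1) ^ j) $$ (i, j)
        = real_jordan_block l \<mu> (- \<nu>) $$ (i, j)"
      by (simp add: minus_one_power_conj real_jordan_block_def psi_cnj_index del: jordan_block_index(1))
  qed (auto simp: real_jordan_block_def)
  then show ?thesis
    using similar_mat_diag_conj[of ?J "2 * l" "\<lambda>i. (- 1) ^ i" "\<lambda>i. (- 1) ^ i"]
    by (simp add: minus_one_power_mult_self)
qed

section \<open>Quaternionic Jordan blocks\<close>

lemma quat_of_complex_simps [simp]:
  "quat_of_complex 0 = 0" "quat_of_complex 1 = 1" "quat_of_complex (- z) = - quat_of_complex z"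
  by (simp_all add: quat_of_complex_def zero_quat_def one_quat_def uminus_quat_def)

lemma quat_jordan_block_carrier [simp]: "quat_jordan_block m z \<in> carrier_mat m m"
  by (simp add: quat_jordan_block_def)

lemma similar_mat_quat_jordan_block_uminus:
  "similar_mat (- quat_jordan_block m z) (quat_jordan_block m (- z))"
  unfolding quat_jordan_block_def quat_of_complex_simps by (rule similar_mat_uminus_jordan_block)

text \<open>Conjugation by the scalar matrix j, because j z (-j) = \<open>cnj z\<close> for complex
  z; here \<open>Quat 0 0 1 0\<close> is j and \<open>Quat 0 0 (- 1) 0\<close> is its
  inverse.\<close>

lemma similar_mat_quat_jordan_block_cnj:
  "similar_mat (quat_jordan_block m z) (quat_jordan_block m (cnj z))"
proof -
  have "mat m m (\<lambda>(i, k). Quat 0 0 1 0 * quat_jordan_block m z $$ (i, k) * Quat 0 0 (- 1) 0)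
      = quat_jordan_block m (cnj z)"
    by (rule eq_matI)
      (auto simp: quat_jordan_block_def quat_of_complex_def times_quat_def one_quat_def zero_quat_def)
  then show ?thesis
    using similar_mat_diag_conj[of "quat_jordan_block m z" m "\<lambda>_. Quat 0 0 1 0" "\<lambda>_. Quat 0 0 (- 1) 0"]
    by (simp add: times_quat_def one_quat_def)
qed

section \<open>Complexification of \<open>Psi\<close>\<close>

text \<open>The intertwiner consists of the eigenvectors \<open>(1, i)\<close> and \<open>(1, -i)\<close> of \<open>psi z\<close>
  for the eigenvalues \<open>z\<close> and \<open>cnj z\<close>.\<close>

lemma similar_mat_complexified_Psi:
  assumes A: "A \<in> carrier_mat n n"
  shows "similar_mat (map_mat of_real (Psi A)) (four_block_mat A (0\<^sub>m n n) (0\<^sub>m n n) (map_mat cnj A))"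
proof -
  define E where "E = mat (2 * n) n (\<lambda>(i, j). if i div 2 = j then (if even i then 1 else \<i>) else 0)"
  \<comment> \<open>\<open>F\<close> collects the dual vectors \<open>(1/2, - \<i>/2)\<close>, so
    that F stacked on its conjugate inverts (E | cnj E).\<close>
  define F where "F = mat n (2 * n) (\<lambda>(i, j). if j div 2 = i then (if even j then 1/2 else - \<i> / 2) else 0)"
  let ?E' = "map_mat cnj E" and ?F' = "map_mat cnj F" and ?P = "map_mat complex_of_real (Psi A)"
  \<comment> \<open>Empty blocks express concatenation: \<open>?S\<close> is (E | cnj E), with lower
    blocks of height zero, and \<open>?T\<close> is F above cnj F, with right blocks of width
    zero.\<close>
  let ?S = "four_block_mat E ?E' (0\<^sub>m 0 n) (0\<^sub>m 0 n)"
  let ?T = "four_block_mat F (0\<^sub>m n 0) ?F' (0\<^sub>m n 0)"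
  have c: "E \<in> carrier_mat (2 * n) n" "F \<in> carrier_mat n (2 * n)" "?P \<in> carrier_mat (2 * n) (2 * n)"
    using A by (auto simp: E_def F_def)
  have PE: "?P * E = E * A"
  proof (rule eq_matI)
    fix i j assume "i < dim_row (E * A)" "j < dim_col (E * A)"
    then have ij: "i < 2 * n" "j < n" "i div 2 < n" using A c by auto
    have "(?P * E) $$ (i, j) = (\<Sum>k = 0..<2 * n. of_real (Psi A $$ (i, k)) * E $$ (k, j))"
      using ij A c by (simp add: scalar_prod_def)
    also have "\<dots> = (\<Sum>k = 0..<n. if k = j then of_real (psi (A $$ (i div 2, j)) $$ (i mod 2, 0))
        + of_real (psi (A $$ (i div 2, j)) $$ (i mod 2, Suc 0)) * \<i> else 0)"
      unfolding sum_double_index using ij A by (intro sum.cong) (auto simp: E_def)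
    also have "\<dots> = (if even i then 1 else \<i>) * A $$ (i div 2, j)"
      using ij by (cases "even i") (simp_all add: psi_index complex_eq_iff mod2_eq_if)
    also have "\<dots> = (\<Sum>k = 0..<n. if k = i div 2 then (if even i then 1 else \<i>) * A $$ (i div 2, j) else 0)"
      using ij by simp
    also have "\<dots> = (\<Sum>k = 0..<n. E $$ (i, k) * A $$ (k, j))"
      using ij by (intro sum.cong) (auto simp: E_def)
    also have "\<dots> = (E * A) $$ (i, j)"
      using ij A c by (simp add: scalar_prod_def)
    finally show "(?P * E) $$ (i, j) = (E * A) $$ (i, j)" .
  qed (use A c in auto)
  have cnj_mult: "map_mat cnj (X * Y) = map_mat cnj X * map_mat cnj Y"
    if "X \<in> carrier_mat r s" "Y \<in> carrier_mat s t" for X Y r s t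
    using that by (intro eq_matI) (auto simp: scalar_prod_def)
  \<comment> \<open>The conjugate of \<open>PE\<close>, since \<open>?P\<close> has real
    entries.\<close>
  have PE': "?P * ?E' = ?E' * map_mat cnj A"
  proof -
    have "map_mat cnj ?P = ?P" by (auto intro: eq_matI)
    then show ?thesis
      using arg_cong[OF PE, of "map_mat cnj"] cnj_mult[OF c(3,1)] cnj_mult[OF c(1) A] by simp
  qed
  have EF: "E * F + ?E' * ?F' = 1\<^sub>m (2 * n)"
  proof (rule eq_matI)
    fix i j assume "i < dim_row (1\<^sub>m (2 * n) :: complex mat)" "j < dim_col (1\<^sub>m (2 * n) :: complex mat)"
    then have ij: "i < 2 * n" "j < 2 * n" "i div 2 < n" "j div 2 < n" by auto
    \<comment> \<open>Inside a diagonal 2 by 2 block, \<open>g\<close> is 1/2 when the parities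
      agree and purely imaginary otherwise; adding its conjugate leaves the identity.\<close>
    define g :: complex where "g = (if even i then 1 else \<i>) * (if even j then 1/2 else - \<i> / 2)"
    have "(E * F) $$ (i, j) = (\<Sum>k = 0..<n. E $$ (i, k) * F $$ (k, j))"
      using ij c by (simp add: scalar_prod_def)
    also have "\<dots> = (\<Sum>k = 0..<n. if k = i div 2 then (if i div 2 = j div 2 then g else 0) else 0)"
      using ij by (intro sum.cong) (auto simp: E_def F_def g_def)
    also have "\<dots> = (if i div 2 = j div 2 then g else 0)"
      using ij by simp
    finally have *: "(E * F) $$ (i, j) = (if i div 2 = j div 2 then g else 0)" .
    have "(E * F + ?E' * ?F') $$ (i, j) = (E * F) $$ (i, j) + cnj ((E * F) $$ (i, j))"
      using ij c cnj_mult[OF c(1,2), symmetric] by simp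
    also have "\<dots> = (if i div 2 = j div 2 \<and> even i = even j then 1 else 0)"
      unfolding * by (auto simp: g_def)
    also have "\<dots> = 1\<^sub>m (2 * n) $$ (i, j)"
    proof -
      have "i div 2 = j div 2 \<and> even i = even j \<longleftrightarrow> i = j"
        using div_mod_2_eqD[of i j] by (auto simp: mod2_eq_if)
      then show ?thesis using ij by simp
    qed
    finally show "(E * F + ?E' * ?F') $$ (i, j) = 1\<^sub>m (2 * n) $$ (i, j)" .
  qed (use c in auto)
  have ST: "?S * ?T = 1\<^sub>m (2 * n)"
  proof -
    have "?S * ?T = four_block_mat (E * F + ?E' * ?F') (0\<^sub>m (2 * n) 0) (0\<^sub>m 0 (2 * n)) (0\<^sub>m 0 0)"
      using c by (subst mult_four_block_mat[of _ "2 * n" n _ n _ 0 _ _ "2 * n" _ 0]) auto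
    then show ?thesis unfolding EF by (auto intro: eq_matI)
  qed
  have S: "?S \<in> carrier_mat (2 * n) (2 * n)" and T: "?T \<in> carrier_mat (2 * n) (2 * n)"
    using c by auto
  let ?D = "four_block_mat A (0\<^sub>m n n) (0\<^sub>m n n) (map_mat cnj A)"
  have D: "?D \<in> carrier_mat (2 * n) (2 * n)" using A by auto
  have "?P * ?S = four_block_mat (?P * E) (?P * ?E') (0\<^sub>m 0 n) (0\<^sub>m 0 n)"
  proof -
    have "?P = four_block_mat ?P (0\<^sub>m (2 * n) 0) (0\<^sub>m 0 (2 * n)) (0\<^sub>m 0 0)"
      using c by (auto intro: eq_matI)
    then have "?P * ?S = four_block_mat ?P (0\<^sub>m (2 * n) 0) (0\<^sub>m 0 (2 * n)) (0\<^sub>m 0 0) * ?S" by simp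
    also have "\<dots> = four_block_mat (?P * E) (?P * ?E') (0\<^sub>m 0 n) (0\<^sub>m 0 n)"
      using c by (subst mult_four_block_mat[of _ "2 * n" "2 * n" _ 0 _ 0 _ _ n _ n]) auto
    finally show ?thesis .
  qed
  also have "\<dots> = ?S * ?D"
    unfolding PE PE' using c A by (subst mult_four_block_mat[of _ "2 * n" n _ n _ 0 _ _ n _ n]) auto
  finally have PS: "?P * ?S = ?S * ?D" .
  have "?P = ?P * (?S * ?T)" unfolding ST by (rule right_mult_one_mat[OF c(3), symmetric])
  also have "\<dots> = ?S * ?D * ?T" using c S T D PS by (metis assoc_mult_mat)
  finally have "?P = ?S * ?D * ?T" .
  moreover have "?T * ?S = 1\<^sub>m (2 * n)" by (rule mat_mult_left_right_inverse[OF S T ST])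
  ultimately show ?thesis using ST S T D c by (intro similar_matI[of _ _ ?S ?T "2 * n"]) simp_all
qed

section \<open>Uniqueness of the canonical forms\<close>

text \<open>Both lists are Jordan forms of the one matrix \<open>jordan_matrix as\<close>, and the
  number of blocks of given positive size and eigenvalue is computed from the matrix alone. Labels
  of size zero are excluded by assumption.\<close>

lemma similar_jordan_matrix_unique:
  fixes as bs :: "(nat \<times> 'a :: field) list"
  assumes sim: "similar_mat (jordan_matrix as) (jordan_matrix bs)"
    and "0 \<notin> fst ` set as" "0 \<notin> fst ` set bs"
  shows "mset as = mset bs"
proof (rule multiset_eqI)
  fix t :: "nat \<times> 'a"
  obtain k x where t: "t = (k, x)" by (cases t)
  have "square_mat (jordan_matrix as)" using similar_mat_square[OF sim] by blast
  then have nf: "jordan_nf (jordan_matrix as) as" "jordan_nf (jordan_matrix as) bs"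
    using assms by (simp_all add: jordan_nf_def similar_mat_refl_square del: square_mat.simps)
  show "count (mset as) t = count (mset bs) t"
  proof (cases "k = 0")
    case True
    then have "t \<notin> set as" "t \<notin> set bs" using assms(2,3) t by (auto simp: image_iff)
    then show ?thesis by (metis count_mset_0_iff)
  next
    case False
    have "length (filter ((=) t) as) = length (filter ((=) t) bs)"
      using compute_nr_of_jordan_blocks[OF nf(1) False, of x]
        compute_nr_of_jordan_blocks[OF nf(2) False, of x] t by simp
    then show ?thesis by (simp add: count_mset count_list_eq_length_filter)
  qed
qed

section \<open>Uniqueness over the quaternions\<close>

definition quat_fst :: "quat \<Rightarrow> complex" where
  "quat_fst q = Complex (qRe q) (qI q)"

definition quat_snd :: "quat \<Rightarrow> complex" where
  "quat_snd q = Complex (qJ q) (qK q)"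

text \<open>From (a + b j)(c + d j) = (a c - b cnj d) + (a d + b cnj c) j. The sign stays with the
  second factor to match the blocks of \<open>complexify_quat\<close>.\<close>

lemma quat_fst_simps:
  "quat_fst 0 = 0" "quat_fst 1 = 1" "quat_fst (p + q) = quat_fst p + quat_fst q"
  "quat_fst (p * q) = quat_fst p * quat_fst q + quat_snd p * (- cnj (quat_snd q))"
  by (simp_all add: quat_fst_def quat_snd_def zero_quat_def one_quat_def plus_quat_def times_quat_def
      complex_eq_iff)

lemma quat_snd_simps:
  "quat_snd 0 = 0" "quat_snd 1 = 0" "quat_snd (p + q) = quat_snd p + quat_snd q"
  "quat_snd (p * q) = quat_fst p * quat_snd q + quat_snd p * cnj (quat_fst q)"
  by (simp_all add: quat_fst_def quat_snd_def zero_quat_def one_quat_def plus_quat_def times_quat_def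
      complex_eq_iff)

lemma quat_of_complex_parts:
  "quat_fst (quat_of_complex z) = z" "quat_snd (quat_of_complex z) = 0"
  by (simp_all add: quat_fst_def quat_snd_def quat_of_complex_def complex_eq_iff)

text \<open>The embedding of quaternionic into complex matrices coming from \<open>q = quat_fst q + quat_snd q j\<close>
  and \<open>j z = cnj z j\<close>.\<close>

definition complexify_quat :: "quat mat \<Rightarrow> complex mat" where
  "complexify_quat A = four_block_mat (map_mat quat_fst A) (map_mat quat_snd A)
     (map_mat (\<lambda>q. - cnj (quat_snd q)) A) (map_mat (\<lambda>q. cnj (quat_fst q)) A)"

text \<open>Each of the four blocks of a complexified product is an instance: its entry map is
  additive and expands a product into two terms.\<close>

lemma map_mat_mult_bilinear:
  fixes f :: "'a :: semiring_0 \<Rightarrow> 'b :: semiring_0"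
  assumes A: "A \<in> carrier_mat n m" and B: "B \<in> carrier_mat m l"
    and f: "f 0 = 0" "\<And>x y. f (x + y) = f x + f y"
    "\<And>x y. f (x * y) = g1 x * h1 y + g2 x * h2 y"
  shows "map_mat f (A * B) = map_mat g1 A * map_mat h1 B + map_mat g2 A * map_mat h2 B"
proof (rule eq_matI)
  fix i j
  assume "i < dim_row (map_mat g1 A * map_mat h1 B + map_mat g2 A * map_mat h2 B)"
    and "j < dim_col (map_mat g1 A * map_mat h1 B + map_mat g2 A * map_mat h2 B)"
  then have ij: "i < n" "j < l" using A B by auto
  have "map_mat f (A * B) $$ (i, j) = f (\<Sum>k = 0..<m. A $$ (i, k) * B $$ (k, j))"
    using ij A B by (simp add: scalar_prod_def)
  also have "\<dots> = (\<Sum>k = 0..<m. f (A $$ (i, k) * B $$ (k, j)))"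
    using sum_comp_morphism[of f "\<lambda>k. A $$ (i, k) * B $$ (k, j)", OF f(1,2)] by (simp add: o_def)
  also have "\<dots> = (map_mat g1 A * map_mat h1 B + map_mat g2 A * map_mat h2 B) $$ (i, j)"
    using ij A B by (simp add: scalar_prod_def f(3) sum.distrib)
  finally show "map_mat f (A * B) $$ (i, j)
      = (map_mat g1 A * map_mat h1 B + map_mat g2 A * map_mat h2 B) $$ (i, j)" .
qed (use A B in auto)

lemma complexify_quat_carrier [simp]:
  "A \<in> carrier_mat n m \<Longrightarrow> complexify_quat A \<in> carrier_mat (n + n) (m + m)"
  unfolding complexify_quat_def by (rule four_block_carrier_mat) auto

lemma complexify_quat_mult:
  assumes "A \<in> carrier_mat n m" "B \<in> carrier_mat m l"
  shows "complexify_quat (A * B) = complexify_quat A * complexify_quat B"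
proof -
  note mult = map_mat_mult_bilinear[OF assms]
  have "complexify_quat A * complexify_quat B = four_block_mat
    (map_mat quat_fst A * map_mat quat_fst B + map_mat quat_snd A * map_mat (\<lambda>q. - cnj (quat_snd q)) B)
    (map_mat quat_fst A * map_mat quat_snd B + map_mat quat_snd A * map_mat (\<lambda>q. cnj (quat_fst q)) B)
    (map_mat (\<lambda>q. - cnj (quat_snd q)) A * map_mat quat_fst B
      + map_mat (\<lambda>q. cnj (quat_fst q)) A * map_mat (\<lambda>q. - cnj (quat_snd q)) B)
    (map_mat (\<lambda>q. - cnj (quat_snd q)) A * map_mat quat_snd B
      + map_mat (\<lambda>q. cnj (quat_fst q)) A * map_mat (\<lambda>q. cnj (quat_fst q)) B)"
    unfolding complexify_quat_def by (rule mult_four_block_mat) (use assms in auto)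
  also have "\<dots> = complexify_quat (A * B)"
    unfolding complexify_quat_def
    by (intro arg_cong4[where f = four_block_mat] mult[symmetric])
      (simp_all add: quat_fst_simps quat_snd_simps)
  finally show ?thesis ..
qed

lemma complexify_quat_one: "complexify_quat (1\<^sub>m n) = 1\<^sub>m (n + n)"
proof -
  have "map_mat quat_fst (1\<^sub>m n) = 1\<^sub>m n" "map_mat quat_snd (1\<^sub>m n) = 0\<^sub>m n n"
    "map_mat (\<lambda>q. - cnj (quat_snd q)) (1\<^sub>m n) = 0\<^sub>m n n" "map_mat (\<lambda>q. cnj (quat_fst q)) (1\<^sub>m n) = 1\<^sub>m n"
    by (auto simp: quat_fst_simps quat_snd_simps intro!: eq_matI)
  then show ?thesis by (simp add: complexify_quat_def)
qed

lemma similar_mat_complexify_quat: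
  assumes "similar_mat A B"
  shows "similar_mat (complexify_quat A) (complexify_quat B)"
proof -
  obtain n P Q where *: "{A, B, P, Q} \<subseteq> carrier_mat n n" "P * Q = 1\<^sub>m n" "Q * P = 1\<^sub>m n" "A = P * B * Q"
    using similar_matD[OF assms] by blast
  have c: "A \<in> carrier_mat n n" "B \<in> carrier_mat n n" "P \<in> carrier_mat n n" "Q \<in> carrier_mat n n"
    using *(1) by auto
  show ?thesis
  proof (rule similar_matI)
    show "{complexify_quat A, complexify_quat B, complexify_quat P, complexify_quat Q}
        \<subseteq> carrier_mat (n + n) (n + n)"
      using c by simp
    show "complexify_quat P * complexify_quat Q = 1\<^sub>m (n + n)"
      "complexify_quat Q * complexify_quat P = 1\<^sub>m (n + n)"
      using *(2,3) complexify_quat_mult[OF c(3,4)] complexify_quat_mult[OF c(4,3)]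
      by (simp_all add: complexify_quat_one)
    show "complexify_quat A = complexify_quat P * complexify_quat B * complexify_quat Q"
      unfolding *(4) complexify_quat_mult[OF mult_carrier_mat[OF c(3,2)] c(4)] complexify_quat_mult[OF c(3,2)] ..
  qed
qed

lemma map_mat_jordan_matrix:
  assumes "f 0 = 0" "f 1 = 1"
  shows "map_mat f (jordan_matrix ts) = jordan_matrix (map (map_prod id f) ts)"
proof -
  have "map_mat f (jordan_block m z) = jordan_block m (f z)" for m z
    using assms by (intro eq_matI) auto
  then show ?thesis
    unfolding jordan_matrix_def diag_block_mat_map[of f, OF assms(1)]
    by (intro arg_cong[where f = diag_block_mat]) auto
qed

lemma jordan_matrix_singleton: "jordan_matrix [(m, z)] = jordan_block m z"
  by (simp only: jordan_matrix_def list.map prod.case diag_block_mat_singleton)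

lemma jordan_matrix_append:
  "jordan_matrix (as @ bs) = four_block_mat (jordan_matrix as)
    (0\<^sub>m (sum_list (map fst as)) (sum_list (map fst bs)))
    (0\<^sub>m (sum_list (map fst bs)) (sum_list (map fst as))) (jordan_matrix bs)"
  unfolding jordan_matrix_def map_append diag_block_mat_append Let_def
  unfolding jordan_matrix_def[symmetric] jordan_matrix_dim ..

text \<open>Complex entries have vanishing \<open>quat_snd\<close>, so the off-diagonal blocks are
  zero and the lower right one is the conjugate of the upper left.\<close>

lemma complexify_quat_jordan_matrix:
  "complexify_quat (diag_block_mat (map (\<lambda>(m, z). quat_jordan_block m z) ts))
    = jordan_matrix (ts @ map (map_prod id cnj) ts)"
proof -
  let ?J = "jordan_matrix ts" and ?n = "sum_list (map fst ts)"
  have D: "diag_block_mat (map (\<lambda>(m, z). quat_jordan_block m z) ts) = map_mat quat_of_complex ?J"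
    by (simp add: map_mat_jordan_matrix) (simp add: jordan_matrix_def quat_jordan_block_def o_def case_prod_unfold)
  have "complexify_quat (map_mat quat_of_complex ?J) = four_block_mat ?J (0\<^sub>m ?n ?n) (0\<^sub>m ?n ?n) (map_mat cnj ?J)"
    unfolding complexify_quat_def
    by (intro arg_cong4[where f = four_block_mat] eq_matI) (simp_all add: quat_of_complex_parts)
  also have "\<dots> = jordan_matrix (ts @ map (map_prod id cnj) ts)"
    by (simp add: map_mat_jordan_matrix jordan_matrix_append o_def)
  finally show ?thesis unfolding D .
qed

text \<open>Labels for the real and quaternionic cases, with one representative of each pair of
  conjugate eigenvalues.\<close>

definition upper_tag :: "nat \<times> complex \<Rightarrow> bool" where
  "upper_tag t \<longleftrightarrow> fst t \<ge> 1 \<and> Im (snd t) \<ge> 0"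

lemma quat_jordan_form_unique:
  assumes "\<forall>t\<in>set ts. upper_tag t" "\<forall>t\<in>set us. upper_tag t"
    and "similar_mat (diag_block_mat (map (\<lambda>(m, z). quat_jordan_block m z) ts))
      (diag_block_mat (map (\<lambda>(m, z). quat_jordan_block m z) us))"
  shows "mset ts = mset us"
proof (rule multiset_eqI)
  fix t :: "nat \<times> complex"
  let ?c = "map_prod id cnj :: nat \<times> complex \<Rightarrow> _"
  have "mset (ts @ map ?c ts) = mset (us @ map ?c us)"
    using similar_mat_complexify_quat[OF assms(3)] assms(1,2)
    unfolding complexify_quat_jordan_matrix
    by (intro similar_jordan_matrix_unique) (auto simp: upper_tag_def)
  then have "count (mset ts + image_mset ?c (mset ts)) t = count (mset us + image_mset ?c (mset us)) t"
    by simp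
  moreover have "?c s = t \<longleftrightarrow> s = ?c t" for s
    by (cases s; cases t) auto
  then have "count (image_mset ?c M) t = count M (?c t)" for M
    by (induction M) simp_all
  ultimately have eq: "count (mset ts) t + count (mset ts) (?c t) = count (mset us) t + count (mset us) (?c t)"
    by simp
  have nz: "count (mset ts) s = 0 \<and> count (mset us) s = 0" if "Im (snd s) < 0" for s
    using assms(1,2) that by (force simp: upper_tag_def count_mset_0_iff)
  \<comment> \<open>Complexification determines only the sum of the counts at \<open>t\<close> and
    its conjugate. For non-real labels one of the two counts is zero; for real labels the sum is
    twice the count.\<close>
  consider "Im (snd t) < 0" | "?c t = t" | "Im (snd (?c t)) < 0"
    by (cases t; rule linorder_cases[of "Im (snd t)" 0]) (auto simp: complex_eq_iff)
  then show "count (mset ts) t = count (mset us) t"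
    using eq nz[of t] nz[of "?c t"] by cases (simp_all del: count_mset_0_iff)
qed

section \<open>Uniqueness over the reals\<close>

text \<open>For a non-real eigenvalue the first component of the label is half the size of the real
  block.\<close>

definition real_block_of_tag :: "nat \<times> complex \<Rightarrow> real mat" where
  "real_block_of_tag t = (if Im (snd t) = 0 then jordan_block (fst t) (Re (snd t))
     else real_jordan_block (fst t) (Re (snd t)) (Im (snd t)))"

text \<open>The Jordan data of the block after complexification. Unlike in the quaternionic case, a
  real eigenvalue is not doubled.\<close>

definition complex_tags :: "nat \<times> complex \<Rightarrow> (nat \<times> complex) list" where
  "complex_tags t = (if Im (snd t) = 0 then [t] else [t, map_prod id cnj t])"

lemma similar_mat_of_real:
  fixes A B :: "real mat"
  assumes "similar_mat A B"
  shows "similar_mat (map_mat complex_of_real A) (map_mat complex_of_real B)"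
proof -
  obtain n P Q where *: "{A, B, P, Q} \<subseteq> carrier_mat n n" "P * Q = 1\<^sub>m n" "Q * P = 1\<^sub>m n" "A = P * B * Q"
    using similar_matD[OF assms] by blast
  let ?h = "map_mat complex_of_real"
  have h_mult: "?h (X * Y) = ?h X * ?h Y" if "X \<in> carrier_mat n n" "Y \<in> carrier_mat n n" for X Y
    by (rule of_real_hom.mat_hom_mult[OF that])
  have c: "A \<in> carrier_mat n n" "B \<in> carrier_mat n n" "P \<in> carrier_mat n n" "Q \<in> carrier_mat n n"
    using *(1) by auto
  show ?thesis
  proof (rule similar_matI)
    show "{?h A, ?h B, ?h P, ?h Q} \<subseteq> carrier_mat n n" using c by simp
    show "?h P * ?h Q = 1\<^sub>m n" "?h Q * ?h P = 1\<^sub>m n"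
      using *(2,3) h_mult[OF c(3,4)] h_mult[OF c(4,3)] by (simp_all add: of_real_hom.mat_hom_one)
    show "?h A = ?h P * ?h B * ?h Q"
      unfolding *(4) h_mult[OF mult_carrier_mat[OF c(3,2)] c(4)] h_mult[OF c(3,2)] ..
  qed
qed

lemma similar_mat_complexified_real_block:
  "similar_mat (map_mat complex_of_real (real_block_of_tag t)) (jordan_matrix (complex_tags t))"
proof (cases t)
  case (Pair m z)
  show ?thesis
  proof (cases "Im z = 0")
    case True
    have "map_mat complex_of_real (jordan_block m (Re z)) = jordan_block m z"
      using True by (intro eq_matI) (auto simp: complex_eq_iff)
    then show ?thesis
      using True Pair similar_mat_refl[of "jordan_block m z" m]
      by (simp add: real_block_of_tag_def complex_tags_def jordan_matrix_singleton)
  next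
    case False
    have "map_mat cnj (jordan_block m z) = jordan_block m (cnj z)" by (intro eq_matI) auto
    then show ?thesis
      using False Pair similar_mat_complexified_Psi[of "jordan_block m z" m]
        jordan_matrix_append[of "[(m, z)]" "[(m, cnj z)]"]
      by (simp add: real_block_of_tag_def complex_tags_def jordan_matrix_singleton real_jordan_block_def)
  qed
qed

lemma real_jordan_form_unique:
  assumes "\<forall>t\<in>set ts. upper_tag t" "\<forall>t\<in>set us. upper_tag t"
    and "similar_mat (diag_block_mat (map real_block_of_tag ts)) (diag_block_mat (map real_block_of_tag us))"
  shows "mset ts = mset us"
proof -
  let ?h = "map_mat complex_of_real"
  have cx: "similar_mat (?h (diag_block_mat (map real_block_of_tag ts)))
      (jordan_matrix (concat (map complex_tags ts)))" for ts
    unfolding diag_block_mat_map[of complex_of_real, OF of_real_0] jordan_matrix_concat_diag_block_mat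
    by (rule similar_mat_diag_block_mat_list_all2)
      (simp add: list_all2_conv_all_nth similar_mat_complexified_real_block)
  \<comment> \<open>Every label contributes itself and at most one further label, which lies
    strictly below the real axis; filtering therefore recovers the original list.\<close>
  have fil: "filter_mset (\<lambda>t. Im (snd t) \<ge> 0) (mset (concat (map complex_tags ts))) = mset ts"
    if "\<forall>t\<in>set ts. upper_tag t" for ts
    using that by (induction ts) (auto simp: complex_tags_def upper_tag_def)
  have "similar_mat (jordan_matrix (concat (map complex_tags ts))) (jordan_matrix (concat (map complex_tags us)))"
    using cx[of ts] cx[of us] similar_mat_of_real[OF assms(3)] similar_mat_sym similar_mat_trans by blast
  then have "mset (concat (map complex_tags ts)) = mset (concat (map complex_tags us))"
    using assms(1,2) by (intro similar_jordan_matrix_unique)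
      (auto simp: complex_tags_def upper_tag_def split: if_splits)
  then show ?thesis using fil[OF assms(1)] fil[OF assms(2)] by simp
qed

section \<open>The characterisation of real elements\<close>

lemma image_mset_sum_mset:
  "image_mset f (\<Sum>\<^sub># Qs) = \<Sum>\<^sub># (image_mset (image_mset f) Qs)"
  by (induction Qs) auto

text \<open>The common pattern of the three cases. Sufficiency rests on \<open>parts\<close>;
  necessity combines \<open>neg\<close>, \<open>unique\<close> and the splitting into orbits with
  \<open>orbit\<close>, which is stated up to similarity because a listed partner may be only
  conjugate to \<open>blk (\<sigma> t)\<close>.\<close>

locale negation_on_labels =
  fixes \<sigma> :: "'t \<Rightarrow> 't" and V :: "'t set" and blk :: "'t \<Rightarrow> 'a :: ring_1 mat"
    and \<P> :: "'a mat multiset set"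
  assumes invol: "\<sigma> (\<sigma> t) = t"
    and closed: "t \<in> V \<Longrightarrow> \<sigma> t \<in> V"
    and neg: "t \<in> V \<Longrightarrow> similar_mat (- blk t) (blk (\<sigma> t))"
    and unique: "set ts \<subseteq> V \<Longrightarrow> set us \<subseteq> V \<Longrightarrow>
      similar_mat (diag_block_mat (map blk ts)) (diag_block_mat (map blk us)) \<Longrightarrow> mset ts = mset us"
    and orbit: "t \<in> V \<Longrightarrow> \<exists>Q\<in>\<P>. rel_mset similar_mat
      (if \<sigma> t = t then {#blk t#} else {#blk t, blk (\<sigma> t)#}) Q"
    and parts: "Q \<in> \<P> \<Longrightarrow> rel_mset similar_mat Q (image_mset uminus Q)"
begin

lemma Ad_GL_real_iff_partitionable:
  assumes X: "X \<in> carrier_mat n n" "jordan_canonical_form (blk ` V) X Bs"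
  shows "Ad_GL_real n X \<longleftrightarrow> partitionable_into \<P> (mset Bs)"
proof -
  have Bs: "set Bs \<subseteq> blk ` V" "similar_mat X (diag_block_mat Bs)"
    using X(2) by (auto simp: jordan_canonical_form_def)
  note Ad = Ad_GL_real_iff_diag_block_mat[OF X(1) Bs(2)]
  show ?thesis
  proof
    assume "partitionable_into \<P> (mset Bs)"
    then have "rel_mset similar_mat (mset Bs) (mset (map uminus Bs))"
      using partitionable_into_imp_rel_mset_uminus[OF parts] by simp
    then show "Ad_GL_real n X"
      unfolding Ad by (rule similar_mat_diag_block_mat_rel_mset)
  next
    assume "Ad_GL_real n X"
    define ts where "ts = map (inv_into V blk) Bs"
    have ts: "set ts \<subseteq> V" "Bs = map blk ts"
      using Bs(1) by (auto simp: ts_def inv_into_into f_inv_into_f subset_iff intro!: nth_equalityI)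
    \<comment> \<open>The form with labels \<open>map \<sigma> ts\<close> belongs to -X, hence by
      realness to X, and \<open>unique\<close> then gives invariance of the labels.\<close>
    have "list_all2 similar_mat (map uminus Bs) (map blk (map \<sigma> ts))"
      using ts neg by (auto simp: list_all2_conv_all_nth subset_iff)
    from similar_mat_diag_block_mat_list_all2[OF this]
    have "similar_mat (diag_block_mat (map blk ts)) (diag_block_mat (map blk (map \<sigma> ts)))"
      using \<open>Ad_GL_real n X\<close> unfolding Ad ts(2)[symmetric] by (rule similar_mat_trans[rotated])
    moreover have "set (map \<sigma> ts) \<subseteq> V" using ts(1) closed by auto
    ultimately have "mset ts = mset (map \<sigma> ts)" by (intro unique ts(1))
    then have "image_mset \<sigma> (mset ts) = mset ts" by simp
    from mset_partition_orbits[of \<sigma>, OF invol this]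
    obtain Qs where Qs: "\<Sum>\<^sub># Qs = mset ts"
      "\<forall>Q\<in>#Qs. \<exists>x\<in>#mset ts. Q = (if \<sigma> x = x then {#x#} else {#x, \<sigma> x#})"
      by blast
    show "partitionable_into \<P> (mset Bs)"
      unfolding partitionable_into_def
    proof (intro exI[of _ "image_mset (image_mset blk) Qs"] conjI ballI)
      show "\<Sum>\<^sub># (image_mset (image_mset blk) Qs) = mset Bs"
        using Qs(1) ts(2) by (simp flip: image_mset_sum_mset)
    next
      fix P assume "P \<in># image_mset (image_mset blk) Qs"
      then obtain Q where Q: "Q \<in># Qs" "P = image_mset blk Q" by auto
      obtain t where "t \<in># mset ts" "Q = (if \<sigma> t = t then {#t#} else {#t, \<sigma> t#})"
        using bspec[OF Qs(2) Q(1)] by (rule bexE)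
      then have "t \<in> V" "P = image_mset blk (if \<sigma> t = t then {#t#} else {#t, \<sigma> t#})"
        using Q(2) ts(1) by auto
      then show "\<exists>Q\<in>\<P>. rel_mset similar_mat P Q"
        using orbit[of t] by (simp split: if_splits)
    qed
  qed
qed

end

section \<open>The three cases R, C and H\<close>

lemma rel_mset_pair: "R a c \<Longrightarrow> R b d \<Longrightarrow> rel_mset R {#a, b#} {#c, d#}"
  by (simp add: rel_mset_Plus rel_mset_Zero)

lemma rel_mset_single: "R a c \<Longrightarrow> rel_mset R {#a#} {#c#}"
  by (simp add: rel_mset_Plus rel_mset_Zero)

text \<open>Negation exchanges the two members: -A ~ B also gives -B ~ A.\<close>

lemma rel_mset_similar_uminus_pair:
  fixes A B :: "'a :: ring_1 mat"
  assumes "similar_mat (- A) B"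
  shows "rel_mset similar_mat {#A, B#} (image_mset uminus {#A, B#})"
proof -
  have "similar_mat A (- B)" using similar_mat_uminus[OF assms] by simp
  from rel_mset_pair[of similar_mat, OF this similar_mat_sym[OF assms]]
  show ?thesis by (simp add: add_mset_commute)
qed

lemma rel_mset_similar_uminus_single:
  fixes A :: "'a :: ring_1 mat"
  assumes "similar_mat (- A) A"
  shows "rel_mset similar_mat {#A#} (image_mset uminus {#A#})"
  using rel_mset_single[of similar_mat, OF similar_mat_sym[OF assms]] by simp

lemma canonical_blocks_R_eq: "canonical_blocks_R = real_block_of_tag ` Collect upper_tag"
proof (intro equalityI subsetI)
  fix B assume "B \<in> canonical_blocks_R"
  then consider m r where "B = jordan_block m r" "m \<ge> 1"
    | l \<mu> \<nu> where "B = real_jordan_block l \<mu> \<nu>" "l \<ge> 1" "\<nu> > 0"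
    by (auto simp: canonical_blocks_R_def)
  then show "B \<in> real_block_of_tag ` Collect upper_tag"
  proof cases
    case 1
    then show ?thesis
      by (intro image_eqI[of _ _ "(m, of_real r)"]) (auto simp: real_block_of_tag_def upper_tag_def)
  next
    case 2
    then show ?thesis
      by (intro image_eqI[of _ _ "(l, Complex \<mu> \<nu>)"]) (auto simp: real_block_of_tag_def upper_tag_def)
  qed
qed (force simp: canonical_blocks_R_def real_block_of_tag_def upper_tag_def)

text \<open>Reflection in the imaginary axis keeps labels in the closed upper half plane. Its fixed
  labels have real part zero and give both kinds of singletons.\<close>

interpretation real: negation_on_labels "map_prod id (\<lambda>z. - cnj z)" "Collect upper_tag"
  real_block_of_tag parts_R
proof
  fix t :: "nat \<times> complex"
  obtain m z where t: "t = (m, z)" by (cases t)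
  assume "t \<in> Collect upper_tag"
  then have mz: "m \<ge> 1" "Im z \<ge> 0" by (auto simp: upper_tag_def t)
  let ?\<sigma> = "map_prod id (\<lambda>z. - cnj z) :: nat \<times> complex \<Rightarrow> _"
  show "similar_mat (- real_block_of_tag t) (real_block_of_tag (?\<sigma> t))"
    using similar_mat_trans[OF similar_mat_real_jordan_block_uminus[of m "Re z" "Im z"]
        similar_mat_real_jordan_block_cnj]
    by (simp add: real_block_of_tag_def t similar_mat_uminus_jordan_block)
  show "\<exists>Q\<in>parts_R. rel_mset similar_mat
      (if ?\<sigma> t = t then {#real_block_of_tag t#} else {#real_block_of_tag t, real_block_of_tag (?\<sigma> t)#}) Q"
  proof (cases "Re z = 0")
    case True
    then have "?\<sigma> t = t" by (simp add: t complex_eq_iff)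
    moreover have "{#real_block_of_tag t#} \<in> parts_R"
      using True mz by (cases "Im z = 0") (force simp: parts_R_def real_block_of_tag_def t)+
    moreover have "similar_mat (real_block_of_tag t) (real_block_of_tag t)"
      by (auto simp: real_block_of_tag_def
          intro: similar_mat_refl jordan_block_carrier real_jordan_block_carrier)
    ultimately show ?thesis by (auto intro!: rel_mset_single)
  next
    case Re: False
    then have \<sigma>: "?\<sigma> t \<noteq> t" by (simp add: t complex_eq_iff)
    show ?thesis
    proof (cases "Im z = 0")
      case True
      then show ?thesis
        using Re mz \<sigma> by (intro bexI[of _ "{#jordan_block m (Re z), jordan_block m (- Re z)#}"])
          (auto simp: t parts_R_def real_block_of_tag_def intro!: rel_mset_pair similar_mat_refl)
    next
      case False
      \<comment> \<open>The listed partner has parameter \<open>- Im z\<close>, whereas the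
        reflected label has \<open>Im z\<close>; conjugate blocks being similar bridges the
        difference.\<close>
      have "{#real_jordan_block m (Re z) (Im z), real_jordan_block m (- Re z) (- Im z)#} \<in> parts_R"
        unfolding parts_R_def using False Re mz
        by (intro UnI1 CollectI exI[of _ m] exI[of _ "Re z"] exI[of _ "Im z"]) simp
      moreover have "rel_mset similar_mat {#real_block_of_tag t, real_block_of_tag (?\<sigma> t)#}
          {#real_jordan_block m (Re z) (Im z), real_jordan_block m (- Re z) (- Im z)#}"
        using False similar_mat_real_jordan_block_cnj[of m "- Re z" "Im z"]
          similar_mat_refl[OF real_jordan_block_carrier]
        by (intro rel_mset_pair) (simp_all add: t real_block_of_tag_def)
      ultimately show ?thesis using \<sigma> by auto
    qed
  qed
next
  fix Q assume Q: "Q \<in> parts_R"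
  have single_real: "similar_mat (- real_jordan_block l 0 \<nu>) (real_jordan_block l 0 \<nu>)" for l \<nu>
    using similar_mat_trans[OF similar_mat_real_jordan_block_uminus similar_mat_real_jordan_block_cnj, of l 0 \<nu>]
    by simp
  have single: "similar_mat (- jordan_block m (0 :: real)) (jordan_block m 0)" for m
    using similar_mat_uminus_jordan_block[of m "0 :: real"] by simp
  from Q consider t \<mu> \<nu> where "Q = {# real_jordan_block t \<mu> \<nu>, real_jordan_block t (- \<mu>) (- \<nu>) #}"
    | m r where "Q = {# jordan_block m r, jordan_block m (- r) #}"
    | l \<nu> where "Q = {# real_jordan_block l 0 \<nu> #}"
    | m where "Q = {# jordan_block m 0 #}"
    unfolding parts_R_def by blast
  then show "rel_mset similar_mat Q (image_mset uminus Q)"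
  proof cases
    case 1
    then show ?thesis
      by (simp only: rel_mset_similar_uminus_pair[OF similar_mat_real_jordan_block_uminus])
  next
    case 2
    then show ?thesis
      by (simp only: rel_mset_similar_uminus_pair[OF similar_mat_uminus_jordan_block])
  next
    case 3
    then show ?thesis
      by (simp only: rel_mset_similar_uminus_single[OF single_real])
  next
    case 4
    then show ?thesis
      by (simp only: rel_mset_similar_uminus_single[OF single])
  qed
next
  show "mset ts = mset us" if "set ts \<subseteq> Collect upper_tag" "set us \<subseteq> Collect upper_tag"
    "similar_mat (diag_block_mat (map real_block_of_tag ts)) (diag_block_mat (map real_block_of_tag us))" for ts us
    using that by (intro real_jordan_form_unique) auto
qed (auto simp: upper_tag_def)

lemma canonical_blocks_C_eq: "canonical_blocks_C = (\<lambda>(m, z). jordan_block m z) ` {t. fst t \<ge> 1}"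
  by (force simp: canonical_blocks_C_def)

text \<open>Here plain negation acts on the labels, and only eigenvalue 0 is fixed.\<close>

interpretation complex: negation_on_labels "map_prod id uminus" "{t. fst t \<ge> 1}"
  "\<lambda>(m, z). jordan_block m z" parts_C
proof
  fix t :: "nat \<times> complex"
  obtain m z where t: "t = (m, z)" by (cases t)
  assume "t \<in> {t. fst t \<ge> 1}"
  then have m: "m \<ge> 1" by (simp add: t)
  let ?b = "\<lambda>(m, z). jordan_block m z :: complex mat"
  let ?\<sigma> = "map_prod id uminus :: nat \<times> complex \<Rightarrow> _"
  show "similar_mat (- ?b t) (?b (?\<sigma> t))"
    by (simp add: t similar_mat_uminus_jordan_block)
  show "\<exists>Q\<in>parts_C. rel_mset similar_mat (if ?\<sigma> t = t then {#?b t#} else {#?b t, ?b (?\<sigma> t)#}) Q"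
  proof (cases "z = 0")
    case True
    then show ?thesis
      using m by (intro bexI[of _ "{#jordan_block m 0#}"])
        (auto simp: t parts_C_def intro!: rel_mset_single similar_mat_refl)
  next
    case False
    then show ?thesis
      using m by (intro bexI[of _ "{#jordan_block m z, jordan_block m (- z)#}"])
        (auto simp: t parts_C_def intro!: rel_mset_pair similar_mat_refl)
  qed
next
  fix Q assume Q: "Q \<in> parts_C"
  have single: "similar_mat (- jordan_block m (0 :: complex)) (jordan_block m 0)" for m
    using similar_mat_uminus_jordan_block[of m "0 :: complex"] by simp
  from Q consider m z where "Q = {# jordan_block m z, jordan_block m (- z) #}"
    | m where "Q = {# jordan_block m 0 #}"
    unfolding parts_C_def by blast
  then show "rel_mset similar_mat Q (image_mset uminus Q)"
  proof cases
    case 1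
    then show ?thesis
      by (simp only: rel_mset_similar_uminus_pair[OF similar_mat_uminus_jordan_block])
  next
    case 2
    then show ?thesis
      by (simp only: rel_mset_similar_uminus_single[OF single])
  qed
next
  show "mset ts = mset us" if "set ts \<subseteq> {t. fst t \<ge> 1}" "set us \<subseteq> {t. fst t \<ge> 1}"
    "similar_mat (diag_block_mat (map (\<lambda>(m, z). jordan_block m z) ts))
      (diag_block_mat (map (\<lambda>(m, z). jordan_block m z) us))" for ts us :: "(nat \<times> complex) list"
    using that by (intro similar_jordan_matrix_unique) (auto simp: jordan_matrix_def)
qed auto

lemma canonical_blocks_H_eq: "canonical_blocks_H = (\<lambda>(m, z). quat_jordan_block m z) ` Collect upper_tag"
  by (force simp: canonical_blocks_H_def upper_tag_def)

interpretation quat: negation_on_labels "map_prod id (\<lambda>z. - cnj z)" "Collect upper_tag"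
  "\<lambda>(m, z). quat_jordan_block m z" parts_H
proof
  fix t :: "nat \<times> complex"
  obtain m z where t: "t = (m, z)" by (cases t)
  assume "t \<in> Collect upper_tag"
  then have mz: "m \<ge> 1" "Im z \<ge> 0" by (auto simp: upper_tag_def t)
  let ?b = "\<lambda>(m, z). quat_jordan_block m z"
  let ?\<sigma> = "map_prod id (\<lambda>z. - cnj z) :: nat \<times> complex \<Rightarrow> _"
  show "similar_mat (- ?b t) (?b (?\<sigma> t))"
    using similar_mat_trans[OF similar_mat_quat_jordan_block_uminus similar_mat_quat_jordan_block_cnj, of m z]
    by (simp add: t)
  show "\<exists>Q\<in>parts_H. rel_mset similar_mat (if ?\<sigma> t = t then {#?b t#} else {#?b t, ?b (?\<sigma> t)#}) Q"
  proof (cases "Re z = 0")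
    case True
    then have "?\<sigma> t = t" by (simp add: t complex_eq_iff)
    then show ?thesis
      using mz True by (intro bexI[of _ "{#quat_jordan_block m z#}"])
        (auto simp: t parts_H_def intro!: rel_mset_single intro: similar_mat_refl quat_jordan_block_carrier)
  next
    case False
    then have "?\<sigma> t \<noteq> t" by (simp add: t complex_eq_iff)
    then show ?thesis
      \<comment> \<open>The conjugate of \<open>- cnj z\<close> is \<open>- z\<close>, the
        eigenvalue of the listed partner.\<close>
      using mz False similar_mat_quat_jordan_block_cnj[of m "- cnj z"]
      by (intro bexI[of _ "{#quat_jordan_block m z, quat_jordan_block m (- z)#}"])
        (auto simp: t parts_H_def intro!: rel_mset_pair intro: similar_mat_refl quat_jordan_block_carrier)
  qed
next
  fix Q assume Q: "Q \<in> parts_H"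
  have single: "similar_mat (- quat_jordan_block m w) (quat_jordan_block m w)" if "Re w = 0" for m w
  proof -
    have "cnj (- w) = w" using that by (simp add: complex_eq_iff)
    then show ?thesis
      using similar_mat_trans[OF similar_mat_quat_jordan_block_uminus similar_mat_quat_jordan_block_cnj, of m w]
      by simp
  qed
  from Q consider m z where "Q = {# quat_jordan_block m z, quat_jordan_block m (- z) #}"
    | m w where "Q = {# quat_jordan_block m w #}" "Re w = 0"
    unfolding parts_H_def by blast
  then show "rel_mset similar_mat Q (image_mset uminus Q)"
  proof cases
    case 1
    then show ?thesis
      by (simp only: rel_mset_similar_uminus_pair[OF similar_mat_quat_jordan_block_uminus])
  next
    case 2
    then show ?thesis
      by (simp only: rel_mset_similar_uminus_single[OF single])
  qed
next
  show "mset ts = mset us" if "set ts \<subseteq> Collect upper_tag" "set us \<subseteq> Collect upper_tag"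
    "similar_mat (diag_block_mat (map (\<lambda>(m, z). quat_jordan_block m z) ts))
      (diag_block_mat (map (\<lambda>(m, z). quat_jordan_block m z) us))" for ts us
    using that by (intro quat_jordan_form_unique) auto
qed (auto simp: upper_tag_def)

theorem theorem4p1:
  fixes n :: nat
  shows
    "(\<forall>X \<in> carrier_mat n n. \<forall>Bs. jordan_canonical_form canonical_blocks_R X Bs \<longrightarrow>
        (Ad_GL_real n X \<longleftrightarrow> partitionable_into parts_R (mset Bs))) \<and>
     (\<forall>X \<in> carrier_mat n n. \<forall>Bs. jordan_canonical_form canonical_blocks_C X Bs \<longrightarrow>
        (Ad_GL_real n X \<longleftrightarrow> partitionable_into parts_C (mset Bs))) \<and>
     (\<forall>X \<in> carrier_mat n n. \<forall>Bs. jordan_canonical_form canonical_blocks_H X Bs \<longrightarrow>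
        (Ad_GL_real n X \<longleftrightarrow> partitionable_into parts_H (mset Bs)))"
  unfolding canonical_blocks_R_eq canonical_blocks_C_eq canonical_blocks_H_eq
  using real.Ad_GL_real_iff_partitionable complex.Ad_GL_real_iff_partitionable
    quat.Ad_GL_real_iff_partitionable
  by blast

end
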